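(* Let $n\ge 3$, let $P=(A_1,\dots,A_n)$ be a labeled $n$-gon in the complex plane with $A_m=(x_m,y_m)$, let $F$ be the polygonal Heronian frieze of order $n$ arising from $P$, and let $C$ be its $3\times n$ coordinate matrix, with minors $m_{ijk}$. Let $1\le i_1<i_2\le n$ and $1\le j_0<j_1<j_2<j_3\le n$ be integers with $(i_1,i_2)\notin\{(j_0,j_1),(j_1,j_2),(j_2,j_3),(j_0,j_3)\}$, and consider the relation $$(\ast)\qquad m_{i_1i_2j_0}m_{j_1j_2j_3}-m_{i_1i_2j_1}m_{j_0j_2j_3}+m_{i_1i_2j_2}m_{j_0j_1j_3}-m_{i_1i_2j_3}m_{j_0j_1j_2}=0 .$$ (a) If $\{i_1,i_2\}\cap\{j_0,j_1,j_2,j_3\}=\emptyset$, then $(\ast)$ is a Heronian minor relation if and only if one of the following holds: - $i_1=1,\ i_2=n,\ j_1=j_0+1,\ j_3=j_2+1$, and the corresponding $S$-relation is $$S_{n,1,j_0}S_{j_0+1,j_2,j_2+1}-S_{n,1,j_0+1}S_{j_0,j_2,j_2+1}+S_{n,1,j_2}S_{j_0,j_0+1,j_2+1}-S_{n,1,j_2+1}S_{j_0,j_0+1,j_2}=0,$$ where $j_0<j_2-1$; - $1\le i_1\le n-1,\ i_2=i_1+1,\ j_1=j_0+1,\ j_3=j_2+1$, and the corresponding $S$-relation is $$S_{i_1,i_1+1,j_0}S_{j_0+1,j_2,j_2+1}-S_{i_1,i_1+1,j_0+1}S_{j_0,j_2,j_2+1}+S_{i_1,i_1+1,j_2}S_{j_0,j_0+1,j_2+1}-S_{i_1,i_1+1,j_2+1}S_{j_0,j_0+1,j_2}=0,$$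 where $j_0<j_2-1$; - $1<i_1<n-1,\ i_2=i_1+1,\ j_0=1,\ j_2=j_1+1,\ j_3=n$, and the corresponding $S$-relation is $$S_{i_1,i_1+1,1}S_{j_1,j_1+1,n}-S_{i_1,i_1+1,j_1}S_{n,1,j_1+1}+S_{i_1,i_1+1,j_1+1}S_{n,1,j_1}-S_{i_1,i_1+1,n}S_{1,j_1,j_1+1}=0,$$ where $1<j_1<n$. (b) If $\{i_1,i_2\}\cap\{j_0,j_1,j_2,j_3\}=\{j_0\}$, then $(\ast)$ is a Heronian minor relation if and only if one of the following holds: - $i_1=1,\ i_2=2,\ j_0=1,\ j_2=j_1+1,\ j_3=n$, and the corresponding $S$-relation is $$-S_{1,2,j_1}S_{n,1,j_1+1}+S_{1,2,j_1+1}S_{n,1,j_1}-S_{1,2,n}S_{1,j_1,j_1+1}=0,$$ where $1<j_1<n$; - $i_1=1,\ i_2=n,\ j_0=1,\ j_1=2,\ j_3=j_2+1$, and the corresponding $S$-relation is $$S_{n,1,2}S_{1,j_2,j_2+1}-S_{n,1,j_2}S_{1,2,j_2+1}+S_{n,1,j_2+1}S_{1,2,j_2}=0,$$ where $2<j_2<n$; - $1\le i_1\le n-1,\ i_2=i_1+1,\ j_0=i_1+1,\ j_1=i_1+2,\ j_3=j_2+1$, and the corresponding $S$-relation is $$-S_{i_1,i_1+1,i_1+2}S_{i_1+1,j_2,j_2+1}+S_{i_1,i_1+1,j_2}S_{i_1+1,i_1+2,j_2+1}-S_{i_1,i_1+1,j_2+1}S_{i_1+1,i_1+2,j_2}=0,$$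 where $i_1+2<j_2<n$. (c) If $\{i_1,i_2\}\cap\{j_0,j_1,j_2,j_3\}=\{j_1\}$, then $(\ast)$ is a Heronian minor relation if and only if one of the following holds: - $1<i_1<n-1,\ i_2=i_1+1,\ j_0=1,\ j_1=i_1+1,\ j_2=i_1+2,\ j_3=n$, and the corresponding $S$-relation is $$S_{i_1,i_1+1,1}S_{i_1+1,i_1+2,n}+S_{i_1,i_1+1,i_1+2}S_{n,1,i_1+1}-S_{i_1,i_1+1,n}S_{1,i_1+1,i_1+2}=0,$$ where $1<i_1<n-1$; - $1<i_1\le n-1,\ i_2=i_1+1,\ j_0=i_1-1,\ j_1=i_1,\ j_3=j_2+1$, and the corresponding $S$-relation is $$S_{i_1,i_1+1,i_1-1}S_{i_1,j_2,j_2+1}+S_{i_1,i_1+1,j_2}S_{i_1-1,i_1,j_2+1}-S_{i_1,i_1+1,j_2+1}S_{i_1-1,i_1,j_2}=0,$$ where $1<i_1<j_2$. (d) If $\{i_1,i_2\}\cap\{j_0,j_1,j_2,j_3\}=\{j_2\}$, then $(\ast)$ is a Heronian minor relation if and only if one of the following holds: - $1<i_1<n-1,\ i_2=i_1+1,\ j_0=1,\ j_1=i_1-1,\ j_2=i_1,\ j_3=n$, and the corresponding $S$-relation is $$S_{i_1,i_1+1,1}S_{i_1-1,i_1,n}-S_{i_1,i_1+1,i_1-1}S_{n,1,i_1}-S_{i_1,i_1+1,n}S_{1,i_1-1,i_1}=0,$$ where $1<i_1<n-1$; - $1\le i_1<n-1,\ i_2=i_1+1,\ j_1=j_0+1,\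 j_2=i_1+1,\ j_3=i_1+2$, and the corresponding $S$-relation is $$S_{i_1,i_1+1,j_0}S_{j_0+1,i_1+1,i_1+2}-S_{i_1,i_1+1,j_0+1}S_{j_0,i_1+1,i_1+2}-S_{i_1,i_1+1,i_1+2}S_{j_0,j_0+1,i_1+1}=0,$$ where $j_0<i_1$. (e) If $\{i_1,i_2\}\cap\{j_0,j_1,j_2,j_3\}=\{j_3\}$, then $(\ast)$ is a Heronian minor relation if and only if one of the following holds: - $i_1=n-1,\ i_2=n,\ j_0=1,\ j_2=j_1+1,\ j_3=n$, and the corresponding $S$-relation is $$S_{n-1,n,1}S_{j_1,j_1+1,n}-S_{n-1,n,j_1}S_{n,1,j_1+1}+S_{n-1,n,j_1+1}S_{n,1,j_1}=0,$$ where $1<j_1<n$; - $i_1=1,\ i_2=n,\ j_1=j_0+1,\ j_2=n-1,\ j_3=n$, and the corresponding $S$-relation is $$S_{n,1,j_0}S_{j_0+1,n-1,n}-S_{n,1,j_0+1}S_{j_0,n-1,n}+S_{n,1,n-1}S_{j_0,j_0+1,n}=0,$$ where $j_0<n-2$; - $1<i_1\le n-1,\ i_2=i_1+1,\ j_1=j_0+1,\ j_2=i_1-1,\ j_3=i_1$, and the corresponding $S$-relation is $$S_{i_1,i_1+1,j_0}S_{j_0+1,i_1-1,i_1}-S_{i_1,i_1+1,j_0+1}S_{j_0,i_1-1,i_1}+S_{i_1,i_1+1,i_1-1}S_{j_0,j_0+1,i_1}=0,$$ where $j_0<i_1-2$.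
   Context: A labeled $n$-gon ($n\ge3$) is an ordered $n$-tuple of points $P=(A_1,\dots,A_n)$ of the complex plane, $A_m=(x_m,y_m)$ (coordinates may be complex numbers). For $i,j,k\in\{1,\dots,n\}$ put $$S_{ijk}=2\big[(x_j-x_i)(y_k-y_i)-(y_j-y_i)(x_k-x_i)\big]$$ (four times the signed area of the triangle $A_iA_jA_k$). The polygonal Heronian frieze $F$ of order $n$ arising from $P$ is the array whose entries are the squared distances $(x_j-x_i)^2+(y_j-y_i)^2$ and the numbers $S_{a,a+1,b}$ and $S_{a,b,b+1}$, $a,b\in\{1,\dots,n\}$, indices modulo $n$. The coordinate matrix $C$ of $F$ (or $P$) is the $3\times n$ matrix whose $m$-th column is $(1,x_m,y_m)^T$. For $i,j,k\in\{1,\dots,n\}$, $m_{ijk}$ is the determinant of the $3\times3$ matrix formed by columns $i,j,k$ of $C$, in this order; thus $S_{ijk}=2m_{ijk}$. The relation $(\ast)$ always holds: it is a Plücker relation for $Gr(3,n)$. Heronian minor: a minor of the form $m_{a,a+1,b}$ or $m_{a,b,b+1}$ with $a,b\in\{1,\dots,n\}$ and addition modulo $n$. This is a condition on index triples, not on numerical values; index triples differing by a cyclic rotation are identified, $m_{ijk}=m_{jki}=m_{kij}$ (so for example $m_{1,b,n}=m_{n,1,b}$ is Heronian). Heronian minor relation: a relation $(\ast)$ in which all the minors appearing are Heronian, up to a sign. Here "up to a sign" refers only to minors of the form $m_{1,n,b}$, $b\in\{1,\dots,n\}$, which are the negatives of the Heronian minors $m_{n,1,b}$; no other transpositions of indices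 are allowed. A summand of $(\ast)$ whose first factor $m_{i_1i_2j_r}$ has a repeated index is zero and is dropped from the relation. Corresponding $S$-relation of a Heronian minor relation $(\ast)$: if $(i_1,i_2)\ne(1,n)$ it is $$S_{i_1i_2j_0}S_{j_1j_2j_3}-S_{i_1i_2j_1}S_{j_0j_2j_3}+S_{i_1i_2j_2}S_{j_0j_1j_3}-S_{i_1i_2j_3}S_{j_0j_1j_2}=0,$$ and if $(i_1,i_2)=(1,n)$ it is $$-S_{n,1,j_0}S_{j_1j_2j_3}+S_{n,1,j_1}S_{j_0j_2j_3}-S_{n,1,j_2}S_{j_0j_1j_3}+S_{n,1,j_3}S_{j_0j_1j_2}=0.$$ It is written up to an overall sign, with zero summands (repeated index) omitted, and using $S_{1,b,n}=S_{n,1,b}$. *)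

theory Defs
  imports "HOL-Analysis.Analysis"
begin

text \<open>A labeled \<open>n\<close>-gon is given by its vertices \<open>P 1, \<dots>, P n\<close>; the values of \<open>P\<close> outside
  \<open>{1..n}\<close> are irrelevant. Both coordinates of a vertex may be complex.\<close>

type_synonym polygon = "nat \<Rightarrow> complex \<times> complex"
type_synonym triple = "nat \<times> nat \<times> nat"

definition sqdist :: "polygon \<Rightarrow> nat \<Rightarrow> nat \<Rightarrow> complex" where
  "sqdist P i j = (fst (P j) - fst (P i))\<^sup>2 + (snd (P j) - snd (P i))\<^sup>2"

definition area4 :: "polygon \<Rightarrow> nat \<Rightarrow> nat \<Rightarrow> nat \<Rightarrow> complex" where
  "area4 P i j k =
     2 * ((fst (P j) - fst (P i)) * (snd (P k) - snd (P i))
        - (snd (P j) - snd (P i)) * (fst (P k) - fst (P i)))"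

text \<open>The successor modulo \<open>n\<close>, with representatives \<open>1, \<dots>, n\<close>.\<close>

definition csucc :: "nat \<Rightarrow> nat \<Rightarrow> nat" where
  "csucc n a = a mod n + 1"

text \<open>The index triples \<open>(a, a+1, b)\<close> and \<open>(a, b, b+1)\<close>, addition modulo \<open>n\<close>.\<close>

definition heronian_triples :: "nat \<Rightarrow> triple set" where
  "heronian_triples n =
     {(a, csucc n a, b) | a b. a \<in> {1..n} \<and> b \<in> {1..n}} \<union>
     {(a, b, csucc n b) | a b. a \<in> {1..n} \<and> b \<in> {1..n}}"

text \<open>The polygonal Heronian frieze as an array, i.e. a partial function on positions. It contains
  the squared distances and only those \<open>S\<^sub>i\<^sub>j\<^sub>k\<close> whose index triple is of the form
  \<open>(a, a+1, b)\<close> or \<open>(a, b, b+1)\<close>.\<close>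

datatype frieze_index = Dist nat nat | Area triple

type_synonym frieze = "frieze_index \<Rightarrow> complex option"

fun heronian_frieze :: "nat \<Rightarrow> polygon \<Rightarrow> frieze" where
  "heronian_frieze n P (Dist a b) =
     (if a \<in> {1..n} \<and> b \<in> {1..n} then Some (sqdist P a b) else None)"
| "heronian_frieze n P (Area (i, j, k)) =
     (if (i, j, k) \<in> heronian_triples n then Some (area4 P i j k) else None)"

text \<open>A matrix with three rows is given by its family of columns; the coordinate matrix of an
  \<open>n\<close>-gon has the columns with index in \<open>{1..n}\<close>.\<close>

type_synonym columns = "nat \<Rightarrow> complex ^ 3"

definition coordinate_matrix :: "polygon \<Rightarrow> columns" where
  "coordinate_matrix P = (\<lambda>m. vector [1, fst (P m), snd (P m)])"

fun minor :: "columns \<Rightarrow> triple \<Rightarrow> complex" where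
  "minor C (i, j, k) = det (transpose (vector [C i, C j, C k] :: complex ^ 3 ^ 3))"

text \<open>Whether a relation is Heronian depends on the indices only, so relations are kept as formal
  objects: the list \<open>[(c\<^sub>1, t\<^sub>1, u\<^sub>1), (c\<^sub>2, t\<^sub>2, u\<^sub>2), \<dots>]\<close> stands for
  \<open>c\<^sub>1 X\<^bsub>t\<^sub>1\<^esub> X\<^bsub>u\<^sub>1\<^esub> + c\<^sub>2 X\<^bsub>t\<^sub>2\<^esub> X\<^bsub>u\<^sub>2\<^esub> + \<dots> = 0\<close>, where \<open>X\<close> is \<open>m\<close> for a
  relation between minors and \<open>S\<close> for a relation between frieze entries.\<close>

type_synonym relation = "(int \<times> triple \<times> triple) list"

definition relation_lhs :: "(triple \<Rightarrow> complex) \<Rightarrow> relation \<Rightarrow> complex" where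
  "relation_lhs X R = (\<Sum>(c, t, u) \<leftarrow> R. of_int c * X t * X u)"

definition pluecker_relation ::
  "nat \<Rightarrow> nat \<Rightarrow> nat \<Rightarrow> nat \<Rightarrow> nat \<Rightarrow> nat \<Rightarrow> relation" where
  "pluecker_relation i1 i2 j0 j1 j2 j3 =
     [( 1, (i1, i2, j0), (j1, j2, j3)),
      (-1, (i1, i2, j1), (j0, j2, j3)),
      ( 1, (i1, i2, j2), (j0, j1, j3)),
      (-1, (i1, i2, j3), (j0, j1, j2))]"

fun repeated_index :: "triple \<Rightarrow> bool" where
  "repeated_index (i, j, k) \<longleftrightarrow> i = j \<or> j = k \<or> i = k"

fun rotate_triple :: "triple \<Rightarrow> triple" where
  "rotate_triple (i, j, k) = (j, k, i)"

definition heronian_minor :: "nat \<Rightarrow> triple \<Rightarrow> bool" where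
  "heronian_minor n t \<longleftrightarrow>
     t \<in> heronian_triples n \<or> rotate_triple t \<in> heronian_triples n \<or>
     rotate_triple (rotate_triple t) \<in> heronian_triples n"

definition heronian_minor_up_to_sign :: "nat \<Rightarrow> triple \<Rightarrow> bool" where
  "heronian_minor_up_to_sign n t \<longleftrightarrow>
     heronian_minor n t \<or> (\<exists>b \<in> {1..n}. t = (1, n, b))"

text \<open>The relation has to hold between the minors of \<open>C\<close> (for the relations above this is always
  the case); the condition on the indices ignores the summands whose first factor vanishes because
  of a repeated index.\<close>

definition heronian_minor_relation :: "nat \<Rightarrow> columns \<Rightarrow> relation \<Rightarrow> bool" where
  "heronian_minor_relation n C R \<longleftrightarrow>
     relation_lhs (minor C) R = 0 \<and>
     (\<forall>(c, t, u) \<in> set R. \<not> repeated_index t \<longrightarrow>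
        heronian_minor_up_to_sign n t \<and> heronian_minor_up_to_sign n u)"

definition S_relation ::
  "nat \<Rightarrow> nat \<Rightarrow> nat \<Rightarrow> nat \<Rightarrow> nat \<Rightarrow> nat \<Rightarrow> nat \<Rightarrow> relation" where
  "S_relation n i1 i2 j0 j1 j2 j3 =
     (if (i1, i2) \<noteq> (1, n) then
        [( 1, (i1, i2, j0), (j1, j2, j3)),
         (-1, (i1, i2, j1), (j0, j2, j3)),
         ( 1, (i1, i2, j2), (j0, j1, j3)),
         (-1, (i1, i2, j3), (j0, j1, j2))]
      else
        [(-1, (n, 1, j0), (j1, j2, j3)),
         ( 1, (n, 1, j1), (j0, j2, j3)),
         (-1, (n, 1, j2), (j0, j1, j3)),
         ( 1, (n, 1, j3), (j0, j1, j2))])"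

text \<open>Equality of \<open>S\<close>-relations: zero summands are omitted, \<open>S\<^bsub>1,b,n\<^esub>\<close> is identified with
  \<open>S\<^bsub>n,1,b\<^esub>\<close>, and an overall sign is irrelevant.\<close>

fun normalize_triple :: "nat \<Rightarrow> triple \<Rightarrow> triple" where
  "normalize_triple n (i, j, k) = (if i = 1 \<and> k = n then (n, 1, j) else (i, j, k))"

definition normalize_relation :: "nat \<Rightarrow> relation \<Rightarrow> relation" where
  "normalize_relation n R =
     map (\<lambda>(c, t, u). (c, normalize_triple n t, normalize_triple n u))
       (filter (\<lambda>(c, t, u). \<not> repeated_index t \<and> \<not> repeated_index u) R)"

definition negate_relation :: "relation \<Rightarrow> relation" where
  "negate_relation R = map (\<lambda>(c, t, u). (- c, t, u)) R"

definition same_S_relation :: "nat \<Rightarrow> relation \<Rightarrow> relation \<Rightarrow> bool" where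
  "same_S_relation n R R' \<longleftrightarrow>
     normalize_relation n R = normalize_relation n R' \<or>
     normalize_relation n R = negate_relation (normalize_relation n R')"

definition holds_in_frieze :: "frieze \<Rightarrow> relation \<Rightarrow> bool" where
  "holds_in_frieze F R \<longleftrightarrow>
     (\<forall>(c, t, u) \<in> set R. Area t \<in> dom F \<and> Area u \<in> dom F) \<and>
     relation_lhs (\<lambda>t. the (F (Area t))) R = 0"

text \<open>``The \<open>S\<close>-relation corresponding to the Heronian minor relation with indices
  \<open>i1, i2; j0, j1, j2, j3\<close> is \<open>R\<close>'': \<open>R\<close> is that relation as a formal expression, and \<open>R\<close> is a true
  relation between entries of the frieze \<open>F\<close>.\<close>

definition corresponding_S_relation ::
  "nat \<Rightarrow> frieze \<Rightarrow> nat \<times> nat \<Rightarrow> nat \<times> nat \<times> nat \<times> nat \<Rightarrow> relation \<Rightarrow> bool" where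
  "corresponding_S_relation n F = (\<lambda>(i1, i2) (j0, j1, j2, j3) R.
     same_S_relation n (S_relation n i1 i2 j0 j1 j2 j3) R \<and> holds_in_frieze F R)"

end

theory Submission
  imports Defs
begin

text \<open>
  Every relation in question is true for all choices of the six indices: \<open>S\<close> is twice the minor of
  the coordinate matrix, so it satisfies the Pluecker relations
  (\<open>pluecker_relation_areas\<close>), and dropping zero summands or replacing
  \<open>S\<^bsub>1,b,n\<^esub>\<close> by \<open>S\<^bsub>n,1,b\<^esub>\<close> does not change the value of the left-hand side. What remains is a
  question about index triples only.

  Place \<open>1, \<dots>, n\<close> on a circle. A triple is Heronian if two of its members are neighbours; the
  orientation of the triple matters only for \<open>(i\<^sub>1, i\<^sub>2, j)\<close> with \<open>j\<close> between \<open>i\<^sub>1\<close> and \<open>i\<^sub>2\<close>. The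
  relation has one summand for each vertex \<open>j\<^sub>r\<close> of the quadrilateral \<open>j\<^sub>0 j\<^sub>1 j\<^sub>2 j\<^sub>3\<close>, except for
  vertices that coincide with \<open>i\<^sub>1\<close> or \<open>i\<^sub>2\<close>.

  The first factors are all Heronian precisely if \<open>i\<^sub>1 i\<^sub>2\<close> is a side of the \<open>n\<close>-gon
  (\<open>first_factors_heronian_iff\<close>). For if it is not a side, then each \<open>j\<^sub>r\<close> is one of \<open>i\<^sub>1\<close>, \<open>i\<^sub>2\<close>, the
  predecessor of \<open>i\<^sub>1\<close> and the successor of \<open>i\<^sub>2\<close>; the four vertices then exhaust these four
  candidates, and \<open>i\<^sub>1 i\<^sub>2\<close> joins consecutive vertices of the quadrilateral, which is excluded.

  The second factor of the summand for \<open>j\<^sub>r\<close> omits \<open>j\<^sub>r\<close>. It contains the two sides of the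
  quadrilateral away from \<open>j\<^sub>r\<close> and a diagonal, which is never a side of the \<open>n\<close>-gon. So one of those
  two sides has to be a side of the \<open>n\<close>-gon. If all four summands are present, this forces two
  opposite sides of the quadrilateral to be sides of the \<open>n\<close>-gon. If \<open>j\<^sub>r\<close> is shared, the
  condition for \<open>j\<^sub>r\<close> is missing. But then a neighbour of \<open>j\<^sub>r\<close> on the circle, namely the other one
  of \<open>i\<^sub>1\<close> and \<open>i\<^sub>2\<close>, is not a vertex of the quadrilateral, so one of the two sides at \<open>j\<^sub>r\<close> is
  not a side of the \<open>n\<close>-gon, and the remaining conditions again force a pair of opposite sides.
  Writing out which sides involve the wrap-around \<open>n, 1\<close> gives the lists of cases.
\<close>

section \<open>Truth of the relations\<close>

lemma minor_altdef:
  "minor C (i, j, k) =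
     C i $ 1 * C j $ 2 * C k $ 3 + C j $ 1 * C k $ 2 * C i $ 3 + C k $ 1 * C i $ 2 * C j $ 3
   - C k $ 1 * C j $ 2 * C i $ 3 - C j $ 1 * C i $ 2 * C k $ 3 - C i $ 1 * C k $ 2 * C j $ 3"
  by (simp add: det_3 transpose_def algebra_simps)

lemma pluecker_relation_minors: "relation_lhs (minor C) (pluecker_relation i1 i2 j0 j1 j2 j3) = 0"
  unfolding relation_lhs_def pluecker_relation_def minor_altdef
  by (simp add: minor_altdef del: minor.simps) algebra

lemma area4_eq_minor: "area4 P i j k = 2 * minor (coordinate_matrix P) (i, j, k)"
  by (simp add: minor_altdef area4_def coordinate_matrix_def algebra_simps del: minor.simps)

definition area_of :: "polygon \<Rightarrow> triple \<Rightarrow> complex" where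
  "area_of P = (\<lambda>(i, j, k). area4 P i j k)"

lemma area_of_eq_minor: "area_of P t = 2 * minor (coordinate_matrix P) t"
  by (cases t) (simp add: area_of_def area4_eq_minor del: minor.simps)

lemma pluecker_relation_areas: "relation_lhs (area_of P) (pluecker_relation i1 i2 j0 j1 j2 j3) = 0"
proof -
  have "relation_lhs (area_of P) R = 4 * relation_lhs (minor (coordinate_matrix P)) R" for R
    by (induction R) (auto simp: relation_lhs_def area_of_eq_minor algebra_simps)
  then show ?thesis
    by (simp add: pluecker_relation_minors)
qed

lemma area_of_repeated: "repeated_index t \<Longrightarrow> area_of P t = 0"
  by (cases t) (auto simp: area_of_def area4_def algebra_simps)

lemma area_of_normalize_triple: "area_of P (normalize_triple n t) = area_of P t"
  by (cases t) (auto simp: area_of_def area4_def algebra_simps)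

lemma area_of_swap: "area_of P (j, i, k) = - area_of P (i, j, k)"
  by (simp add: area_of_def area4_def algebra_simps)

text \<open>For \<open>(i\<^sub>1, i\<^sub>2) = (1, n)\<close> the signs in the definition compensate for exchanging \<open>1\<close> and \<open>n\<close> in the
  first factors.\<close>

lemma S_relation_holds: "relation_lhs (area_of P) (S_relation n i1 i2 j0 j1 j2 j3) = 0"
proof (cases "(i1, i2) = (1, n)")
  case True
  then have "relation_lhs (area_of P) (S_relation n i1 i2 j0 j1 j2 j3) =
      relation_lhs (area_of P) (pluecker_relation i1 i2 j0 j1 j2 j3)"
    by (simp add: S_relation_def pluecker_relation_def relation_lhs_def area_of_swap[of P n "Suc 0"])
  then show ?thesis
    by (simp add: pluecker_relation_areas)
next
  case False
  then have "S_relation n i1 i2 j0 j1 j2 j3 = pluecker_relation i1 i2 j0 j1 j2 j3"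
    by (auto simp: S_relation_def pluecker_relation_def)
  then show ?thesis
    by (simp add: pluecker_relation_areas)
qed

lemma relation_lhs_normalize:
  "relation_lhs (area_of P) (normalize_relation n R) = relation_lhs (area_of P) R"
  by (induction R)
    (auto simp: relation_lhs_def normalize_relation_def area_of_normalize_triple area_of_repeated
      simp del: normalize_triple.simps repeated_index.simps)

lemma relation_lhs_negate: "relation_lhs X (negate_relation R) = - relation_lhs X R"
  by (induction R) (auto simp: relation_lhs_def negate_relation_def)

lemma same_S_relation_refl: "same_S_relation n R R"
  by (simp add: same_S_relation_def)

lemma same_S_relation_lhs:
  assumes "same_S_relation n R R'"
  shows "relation_lhs (area_of P) R = 0 \<longleftrightarrow> relation_lhs (area_of P) R' = 0"
  using assms unfolding same_S_relation_def
  by (metis relation_lhs_normalize relation_lhs_negate neg_equal_0_iff_equal)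

lemma area_in_frieze_iff: "Area t \<in> dom (heronian_frieze n P) \<longleftrightarrow> t \<in> heronian_triples n"
  by (cases t) (auto split: if_splits)

lemma frieze_entry: "t \<in> heronian_triples n \<Longrightarrow> the (heronian_frieze n P (Area t)) = area_of P t"
  by (cases t) (auto simp: area_of_def)

text \<open>Correspondence is a purely formal condition: once the relation is formally the right one, it is
  automatically true, and only the membership of its entries in the frieze is left to check.\<close>

lemma corresponding_S_relation_iff:
  "corresponding_S_relation n (heronian_frieze n P) (i1, i2) (j0, j1, j2, j3) R \<longleftrightarrow>
     same_S_relation n (S_relation n i1 i2 j0 j1 j2 j3) R \<and>
     (\<forall>(c, t, u) \<in> set R. t \<in> heronian_triples n \<and> u \<in> heronian_triples n)"
proof -
  have "relation_lhs (\<lambda>t. the (heronian_frieze n P (Area t))) R = relation_lhs (area_of P) R"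
    if "\<forall>(c, t, u) \<in> set R. t \<in> heronian_triples n \<and> u \<in> heronian_triples n"
    unfolding relation_lhs_def using that
    by (auto intro!: arg_cong[where f = sum_list] map_cong simp: frieze_entry
        simp del: heronian_frieze.simps)
  then show ?thesis
    using same_S_relation_lhs[of n "S_relation n i1 i2 j0 j1 j2 j3" R P] S_relation_holds
    unfolding corresponding_S_relation_def holds_in_frieze_def
    by (auto simp: area_in_frieze_iff)
qed

section \<open>Heronian index triples\<close>

lemma csucc_eq: "a \<in> {1..n} \<Longrightarrow> csucc n a = (if a = n then 1 else a + 1)"
  by (auto simp: csucc_def)

lemma mem_heronian_triples_iff:
  assumes "n \<ge> 1"
  shows "(i, j, k) \<in> heronian_triples n \<longleftrightarrow>
     i \<in> {1..n} \<and> j \<in> {1..n} \<and> k \<in> {1..n} \<and> (j = csucc n i \<or> k = csucc n j)"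
proof -
  have "csucc n a \<in> {1..n}" if "a \<in> {1..n}" for a
    using that by (auto simp: csucc_eq)
  then show ?thesis
    by (auto simp: heronian_triples_def)
qed

lemma heronian_minor_iff:
  assumes "n \<ge> 1"
  shows "heronian_minor n (i, j, k) \<longleftrightarrow>
     i \<in> {1..n} \<and> j \<in> {1..n} \<and> k \<in> {1..n} \<and>
     (j = csucc n i \<or> k = csucc n j \<or> i = csucc n k)"
  unfolding heronian_minor_def using assms by (auto simp: mem_heronian_triples_iff)

text \<open>For \<open>1 \<le> a < b \<le> n\<close> this says that \<open>a\<close> and \<open>b\<close> are neighbours on the circle.\<close>

definition side :: "nat \<Rightarrow> nat \<Rightarrow> nat \<Rightarrow> bool" where
  "side n a b \<longleftrightarrow> b = a + 1 \<or> a = 1 \<and> b = n"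

text \<open>The order \<open>a < b < c\<close> is the cyclic one, so any two neighbours in the triple
  occur in the orientation that is required of a Heronian triple.\<close>

lemma heronian_sorted_iff:
  assumes "1 \<le> a" "a < b" "b < c" "c \<le> n"
  shows "heronian_minor_up_to_sign n (a, b, c) \<longleftrightarrow> side n a b \<or> side n b c \<or> side n a c"
  using assms by (auto simp: heronian_minor_up_to_sign_def heronian_minor_iff csucc_eq side_def)

text \<open>If \<open>i\<^sub>1 i\<^sub>2\<close> is not a side, a \<open>j\<close> between them does not help even when it is adjacent to one of
  them, because \<open>(i\<^sub>1, i\<^sub>2, j)\<close> then runs against the cyclic order. If \<open>(i\<^sub>1, i\<^sub>2) = (1, n)\<close>, all
  the triples are covered by the sign convention.\<close>

lemma heronian_first_factor_iff:
  assumes "1 \<le> i1" "i1 < i2" "i2 \<le> n" "j \<in> {1..n}"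
  shows "heronian_minor_up_to_sign n (i1, i2, j) \<longleftrightarrow>
     side n i1 i2 \<or> j = csucc n i2 \<or> i1 = csucc n j"
  using assms by (auto simp: heronian_minor_up_to_sign_def heronian_minor_iff csucc_eq side_def)

section \<open>Index data of Heronian minor relations\<close>

text \<open>The index data of a relation that is not excluded in advance. When \<open>i\<^sub>1, i\<^sub>2\<close> are consecutive
  vertices of the quadrilateral, the relation is trivial: two summands vanish and the other two cancel.\<close>

locale pluecker_indices =
  fixes n i1 i2 j0 j1 j2 j3 :: nat
  assumes i_ordered: "1 \<le> i1" "i1 < i2" "i2 \<le> n"
    and j_ordered: "1 \<le> j0" "j0 < j1" "j1 < j2" "j2 < j3" "j3 \<le> n"
    and not_consecutive: "(i1, i2) \<notin> {(j0, j1), (j1, j2), (j2, j3), (j0, j3)}"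
begin

text \<open>Only four values are possible for the \<open>j\<^sub>r\<close> when \<open>i\<^sub>1 i\<^sub>2\<close> is not a side, and none of them lies
  strictly between \<open>i\<^sub>1\<close> and \<open>i\<^sub>2\<close>. Four distinct vertices must use all of them, in particular \<open>i\<^sub>1\<close>
  and \<open>i\<^sub>2\<close>, and these are then consecutive.\<close>

lemma first_factors_heronian_iff:
  "(\<forall>j \<in> {j0, j1, j2, j3} - {i1, i2}. heronian_minor_up_to_sign n (i1, i2, j)) \<longleftrightarrow> side n i1 i2"
proof -
  have J: "j \<in> {1..n}" if "j \<in> {j0, j1, j2, j3}" for j
    using that j_ordered by auto
  note first = heronian_first_factor_iff[OF i_ordered J]
  show ?thesis
  proof
    assume *: "\<forall>j \<in> {j0, j1, j2, j3} - {i1, i2}. heronian_minor_up_to_sign n (i1, i2, j)"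
    show "side n i1 i2"
    proof (rule ccontr)
      assume "\<not> side n i1 i2"
      \<comment> \<open>\<open>p\<close> is the cyclic predecessor of \<open>i\<^sub>1\<close>.\<close>
      define p where "p = (if i1 = 1 then n else i1 - 1)"
      have near: "j \<in> {i1, i2, csucc n i2, p}" if "j \<in> {j0, j1, j2, j3}" for j
      proof -
        have "j = i1 \<or> j = i2 \<or> j = csucc n i2 \<or> i1 = csucc n j"
          using * that first[OF that] \<open>\<not> side n i1 i2\<close> by blast
        then show ?thesis
          using J[OF that] i_ordered by (auto simp: csucc_eq p_def split: if_splits)
      qed
      have "card {i1, i2, csucc n i2, p} \<le> card {j0, j1, j2, j3}"
        using j_ordered by (simp add: card_insert_if)
      then have eq: "{j0, j1, j2, j3} = {i1, i2, csucc n i2, p}"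
        by (intro card_seteq) (use near in auto)
      have "\<not> (i1 < j \<and> j < i2)" if "j \<in> {j0, j1, j2, j3}" for j
        using near[OF that] i_ordered by (auto simp: csucc_eq p_def split: if_splits)
      then have gap: "\<not> (i1 < j0 \<and> j0 < i2)" "\<not> (i1 < j1 \<and> j1 < i2)"
          "\<not> (i1 < j2 \<and> j2 < i2)" "\<not> (i1 < j3 \<and> j3 < i2)"
        by simp_all
      have "i1 \<in> {j0, j1, j2, j3}" "i2 \<in> {j0, j1, j2, j3}"
        unfolding eq by auto
      then show False
        using gap i_ordered(2) j_ordered not_consecutive by (elim insertE emptyE; simp)
    qed
  next
    assume "side n i1 i2"
    then show "\<forall>j \<in> {j0, j1, j2, j3} - {i1, i2}. heronian_minor_up_to_sign n (i1, i2, j)"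
      using first by blast
  qed
qed

lemma heronian_minor_relation_iff:
  "heronian_minor_relation n C (pluecker_relation i1 i2 j0 j1 j2 j3) \<longleftrightarrow>
     side n i1 i2 \<and>
     (j0 \<notin> {i1, i2} \<longrightarrow> side n j1 j2 \<or> side n j2 j3) \<and>
     (j1 \<notin> {i1, i2} \<longrightarrow> side n j2 j3 \<or> side n j0 j3) \<and>
     (j2 \<notin> {i1, i2} \<longrightarrow> side n j0 j1 \<or> side n j0 j3) \<and>
     (j3 \<notin> {i1, i2} \<longrightarrow> side n j0 j1 \<or> side n j1 j2)"
proof -
  have rep: "repeated_index (i1, i2, j) \<longleftrightarrow> j \<in> {i1, i2}" for j
    using i_ordered by auto
  have second:
    "heronian_minor_up_to_sign n (j1, j2, j3) \<longleftrightarrow> side n j1 j2 \<or> side n j2 j3"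
    "heronian_minor_up_to_sign n (j0, j2, j3) \<longleftrightarrow> side n j2 j3 \<or> side n j0 j3"
    "heronian_minor_up_to_sign n (j0, j1, j3) \<longleftrightarrow> side n j0 j1 \<or> side n j0 j3"
    "heronian_minor_up_to_sign n (j0, j1, j2) \<longleftrightarrow> side n j0 j1 \<or> side n j1 j2"
    using j_ordered by (auto simp: heronian_sorted_iff side_def)
  have "heronian_minor_relation n C (pluecker_relation i1 i2 j0 j1 j2 j3) \<longleftrightarrow>
     (\<forall>j \<in> {j0, j1, j2, j3} - {i1, i2}. heronian_minor_up_to_sign n (i1, i2, j)) \<and>
     (j0 \<notin> {i1, i2} \<longrightarrow> heronian_minor_up_to_sign n (j1, j2, j3)) \<and>
     (j1 \<notin> {i1, i2} \<longrightarrow> heronian_minor_up_to_sign n (j0, j2, j3)) \<and>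
     (j2 \<notin> {i1, i2} \<longrightarrow> heronian_minor_up_to_sign n (j0, j1, j3)) \<and>
     (j3 \<notin> {i1, i2} \<longrightarrow> heronian_minor_up_to_sign n (j0, j1, j2))"
    unfolding heronian_minor_relation_def pluecker_relation_minors
    by (simp add: pluecker_relation_def rep del: repeated_index.simps) blast
  then show ?thesis
    unfolding second first_factors_heronian_iff by blast
qed

text \<open>The wrap-around \<open>n, 1\<close> can only occur between the last and the first vertex, and that pair is
  never a pair of successive integers.\<close>

lemma quadrilateral_sides:
  "side n j0 j1 \<longleftrightarrow> j1 = j0 + 1" "side n j1 j2 \<longleftrightarrow> j2 = j1 + 1" "side n j2 j3 \<longleftrightarrow> j3 = j2 + 1"
  "side n j0 j3 \<longleftrightarrow> j0 = 1 \<and> j3 = n"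
  using j_ordered by (auto simp: side_def)

lemma one_shared_vertex:
  assumes "{i1, i2} \<inter> {j0, j1, j2, j3} = {j}"
  obtains "i1 = j" "i2 \<notin> {j0, j1, j2, j3}" | "i2 = j" "i1 \<notin> {j0, j1, j2, j3}"
proof -
  have "j \<in> {i1, i2}" "i1 \<in> {j0, j1, j2, j3} \<Longrightarrow> i1 = j" "i2 \<in> {j0, j1, j2, j3} \<Longrightarrow> i2 = j"
    using assms by blast+
  then show thesis
    using that i_ordered(2) by blast
qed

text \<open>Here all four conditions on the sides \<open>e\<^sub>0, e\<^sub>1, e\<^sub>2, e\<^sub>3\<close> of the quadrilateral are present, and
  \<open>(e\<^sub>1 \<or> e\<^sub>2) \<and> (e\<^sub>2 \<or> e\<^sub>3) \<and> (e\<^sub>3 \<or> e\<^sub>0) \<and> (e\<^sub>0 \<or> e\<^sub>1)\<close> is equivalent to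
  \<open>e\<^sub>0 \<and> e\<^sub>2 \<or> e\<^sub>1 \<and> e\<^sub>3\<close>.\<close>

lemma heronian_iff_disjoint:
  assumes "{i1, i2} \<inter> {j0, j1, j2, j3} = {}"
  shows "heronian_minor_relation n C (pluecker_relation i1 i2 j0 j1 j2 j3) \<longleftrightarrow>
    (i1 = 1 \<and> i2 = n \<or> i2 = i1 + 1) \<and> j1 = j0 + 1 \<and> j3 = j2 + 1 \<or>
    i2 = i1 + 1 \<and> j0 = 1 \<and> j2 = j1 + 1 \<and> j3 = n"
proof -
  have "i1 \<notin> {j0, j1, j2, j3}" "i2 \<notin> {j0, j1, j2, j3}"
    using assms by auto
  then show ?thesis
    unfolding heronian_minor_relation_iff quadrilateral_sides
    using i_ordered j_ordered by (auto simp: side_def)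
qed

text \<open>In this and the next three lemmas the shared vertex \<open>j\<^sub>r\<close> drops one of the four conditions, but
  the other end of the side \<open>i\<^sub>1 i\<^sub>2\<close> is a neighbour of \<open>j\<^sub>r\<close> that the quadrilateral misses, and this
  excludes one side of the quadrilateral at \<open>j\<^sub>r\<close>. Which side is excluded depends on whether
  \<open>j\<^sub>r\<close> is \<open>i\<^sub>1\<close> or \<open>i\<^sub>2\<close> and on whether \<open>i\<^sub>1 i\<^sub>2\<close> is the wrap-around \<open>n, 1\<close>.\<close>

lemma heronian_iff_shared_j0:
  assumes "{i1, i2} \<inter> {j0, j1, j2, j3} = {j0}"
  shows "heronian_minor_relation n C (pluecker_relation i1 i2 j0 j1 j2 j3) \<longleftrightarrow>
    i1 = 1 \<and> i2 = 2 \<and> j0 = 1 \<and> j2 = j1 + 1 \<and> j3 = n \<or>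
    i1 = 1 \<and> i2 = n \<and> j0 = 1 \<and> j1 = 2 \<and> j3 = j2 + 1 \<or>
    i2 = i1 + 1 \<and> j0 = i1 + 1 \<and> j1 = i1 + 2 \<and> j3 = j2 + 1"
  using assms
proof (cases rule: one_shared_vertex)
  case 1
  then show ?thesis
    unfolding heronian_minor_relation_iff quadrilateral_sides
    using i_ordered j_ordered by (auto simp: side_def)
next
  case 2
  then show ?thesis
    unfolding heronian_minor_relation_iff quadrilateral_sides
    using i_ordered j_ordered by (auto simp: side_def)
qed

lemma heronian_iff_shared_j1:
  assumes "{i1, i2} \<inter> {j0, j1, j2, j3} = {j1}"
  shows "heronian_minor_relation n C (pluecker_relation i1 i2 j0 j1 j2 j3) \<longleftrightarrow>
    i2 = i1 + 1 \<and> j0 = 1 \<and> j1 = i1 + 1 \<and> j2 = i1 + 2 \<and> j3 = n \<or>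
    i1 = j0 + 1 \<and> i2 = j0 + 2 \<and> j1 = j0 + 1 \<and> j3 = j2 + 1"
  using assms
proof (cases rule: one_shared_vertex)
  case 1
  then show ?thesis
    unfolding heronian_minor_relation_iff quadrilateral_sides
    using i_ordered j_ordered by (auto simp: side_def)
next
  case 2
  then show ?thesis
    unfolding heronian_minor_relation_iff quadrilateral_sides
    using i_ordered j_ordered by (auto simp: side_def)
qed

lemma heronian_iff_shared_j2:
  assumes "{i1, i2} \<inter> {j0, j1, j2, j3} = {j2}"
  shows "heronian_minor_relation n C (pluecker_relation i1 i2 j0 j1 j2 j3) \<longleftrightarrow>
    i1 = j1 + 1 \<and> i2 = j1 + 2 \<and> j0 = 1 \<and> j2 = j1 + 1 \<and> j3 = n \<or>
    i2 = i1 + 1 \<and> j1 = j0 + 1 \<and> j2 = i1 + 1 \<and> j3 = i1 + 2"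
  using assms
proof (cases rule: one_shared_vertex)
  case 1
  then show ?thesis
    unfolding heronian_minor_relation_iff quadrilateral_sides
    using i_ordered j_ordered by (auto simp: side_def)
next
  case 2
  then show ?thesis
    unfolding heronian_minor_relation_iff quadrilateral_sides
    using i_ordered j_ordered by (auto simp: side_def)
qed

lemma heronian_iff_shared_j3:
  assumes "{i1, i2} \<inter> {j0, j1, j2, j3} = {j3}"
  shows "heronian_minor_relation n C (pluecker_relation i1 i2 j0 j1 j2 j3) \<longleftrightarrow>
    i1 + 1 = n \<and> i2 = n \<and> j0 = 1 \<and> j2 = j1 + 1 \<and> j3 = n \<or>
    i1 = 1 \<and> i2 = n \<and> j1 = j0 + 1 \<and> j2 + 1 = n \<and> j3 = n \<or>
    i1 = j2 + 1 \<and> i2 = j2 + 2 \<and> j1 = j0 + 1 \<and> j3 = j2 + 1"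
  using assms
proof (cases rule: one_shared_vertex)
  case 1
  then show ?thesis
    unfolding heronian_minor_relation_iff quadrilateral_sides
    using i_ordered j_ordered by (auto simp: side_def)
next
  case 2
  then show ?thesis
    unfolding heronian_minor_relation_iff quadrilateral_sides
    using i_ordered j_ordered by (auto simp: side_def)
qed

end

section \<open>The relations in the frieze\<close>

theorem theorem4p9:
  fixes n :: nat and P :: polygon and F :: frieze and C :: columns
    and i1 i2 j0 j1 j2 j3 :: nat
  assumes "n \<ge> 3"
    and "F = heronian_frieze n P"
    and "C = coordinate_matrix P"
    and "1 \<le> i1" "i1 < i2" "i2 \<le> n"
    and "1 \<le> j0" "j0 < j1" "j1 < j2" "j2 < j3" "j3 \<le> n"
    and "(i1, i2) \<notin> {(j0, j1), (j1, j2), (j2, j3), (j0, j3)}"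
  shows
    "({i1, i2} \<inter> {j0, j1, j2, j3} = {} \<longrightarrow>
       (heronian_minor_relation n C (pluecker_relation i1 i2 j0 j1 j2 j3) \<longleftrightarrow>
          (i1 = 1 \<and> i2 = n \<and> j1 = j0 + 1 \<and> j3 = j2 + 1 \<and> j0 < j2 - 1 \<and>
           corresponding_S_relation n F (i1, i2) (j0, j1, j2, j3)
             [( 1, (n, 1, j0), (j0 + 1, j2, j2 + 1)),
              (-1, (n, 1, j0 + 1), (j0, j2, j2 + 1)),
              ( 1, (n, 1, j2), (j0, j0 + 1, j2 + 1)),
              (-1, (n, 1, j2 + 1), (j0, j0 + 1, j2))]) \<or>
          (1 \<le> i1 \<and> i1 \<le> n - 1 \<and> i2 = i1 + 1 \<and> j1 = j0 + 1 \<and> j3 = j2 + 1 \<and> j0 < j2 - 1 \<and>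
           corresponding_S_relation n F (i1, i2) (j0, j1, j2, j3)
             [( 1, (i1, i1 + 1, j0), (j0 + 1, j2, j2 + 1)),
              (-1, (i1, i1 + 1, j0 + 1), (j0, j2, j2 + 1)),
              ( 1, (i1, i1 + 1, j2), (j0, j0 + 1, j2 + 1)),
              (-1, (i1, i1 + 1, j2 + 1), (j0, j0 + 1, j2))]) \<or>
          (1 < i1 \<and> i1 < n - 1 \<and> i2 = i1 + 1 \<and> j0 = 1 \<and> j2 = j1 + 1 \<and> j3 = n \<and> 1 < j1 \<and> j1 < n \<and>
           corresponding_S_relation n F (i1, i2) (j0, j1, j2, j3)
             [( 1, (i1, i1 + 1, 1), (j1, j1 + 1, n)),
              (-1, (i1, i1 + 1, j1), (n, 1, j1 + 1)),
              ( 1, (i1, i1 + 1, j1 + 1), (n, 1, j1)),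
              (-1, (i1, i1 + 1, n), (1, j1, j1 + 1))]))) \<and>
     ({i1, i2} \<inter> {j0, j1, j2, j3} = {j0} \<longrightarrow>
       (heronian_minor_relation n C (pluecker_relation i1 i2 j0 j1 j2 j3) \<longleftrightarrow>
          (i1 = 1 \<and> i2 = 2 \<and> j0 = 1 \<and> j2 = j1 + 1 \<and> j3 = n \<and> 1 < j1 \<and> j1 < n \<and>
           corresponding_S_relation n F (i1, i2) (j0, j1, j2, j3)
             [(-1, (1, 2, j1), (n, 1, j1 + 1)),
              ( 1, (1, 2, j1 + 1), (n, 1, j1)),
              (-1, (1, 2, n), (1, j1, j1 + 1))]) \<or>
          (i1 = 1 \<and> i2 = n \<and> j0 = 1 \<and> j1 = 2 \<and> j3 = j2 + 1 \<and> 2 < j2 \<and> j2 < n \<and>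
           corresponding_S_relation n F (i1, i2) (j0, j1, j2, j3)
             [( 1, (n, 1, 2), (1, j2, j2 + 1)),
              (-1, (n, 1, j2), (1, 2, j2 + 1)),
              ( 1, (n, 1, j2 + 1), (1, 2, j2))]) \<or>
          (1 \<le> i1 \<and> i1 \<le> n - 1 \<and> i2 = i1 + 1 \<and> j0 = i1 + 1 \<and> j1 = i1 + 2 \<and> j3 = j2 + 1 \<and> i1 + 2 < j2 \<and> j2 < n \<and>
           corresponding_S_relation n F (i1, i2) (j0, j1, j2, j3)
             [(-1, (i1, i1 + 1, i1 + 2), (i1 + 1, j2, j2 + 1)),
              ( 1, (i1, i1 + 1, j2), (i1 + 1, i1 + 2, j2 + 1)),
              (-1, (i1, i1 + 1, j2 + 1), (i1 + 1, i1 + 2, j2))]))) \<and>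
     ({i1, i2} \<inter> {j0, j1, j2, j3} = {j1} \<longrightarrow>
       (heronian_minor_relation n C (pluecker_relation i1 i2 j0 j1 j2 j3) \<longleftrightarrow>
          (1 < i1 \<and> i1 < n - 1 \<and> i2 = i1 + 1 \<and> j0 = 1 \<and> j1 = i1 + 1 \<and> j2 = i1 + 2 \<and> j3 = n \<and>
           corresponding_S_relation n F (i1, i2) (j0, j1, j2, j3)
             [( 1, (i1, i1 + 1, 1), (i1 + 1, i1 + 2, n)),
              ( 1, (i1, i1 + 1, i1 + 2), (n, 1, i1 + 1)),
              (-1, (i1, i1 + 1, n), (1, i1 + 1, i1 + 2))]) \<or>
          (1 < i1 \<and> i1 \<le> n - 1 \<and> i2 = i1 + 1 \<and> j0 = i1 - 1 \<and> j1 = i1 \<and> j3 = j2 + 1 \<and> 1 < i1 \<and> i1 < j2 \<and>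
           corresponding_S_relation n F (i1, i2) (j0, j1, j2, j3)
             [( 1, (i1, i1 + 1, i1 - 1), (i1, j2, j2 + 1)),
              ( 1, (i1, i1 + 1, j2), (i1 - 1, i1, j2 + 1)),
              (-1, (i1, i1 + 1, j2 + 1), (i1 - 1, i1, j2))]))) \<and>
     ({i1, i2} \<inter> {j0, j1, j2, j3} = {j2} \<longrightarrow>
       (heronian_minor_relation n C (pluecker_relation i1 i2 j0 j1 j2 j3) \<longleftrightarrow>
          (1 < i1 \<and> i1 < n - 1 \<and> i2 = i1 + 1 \<and> j0 = 1 \<and> j1 = i1 - 1 \<and> j2 = i1 \<and> j3 = n \<and>
           corresponding_S_relation n F (i1, i2) (j0, j1, j2, j3)
             [( 1, (i1, i1 + 1, 1), (i1 - 1, i1, n)),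
              (-1, (i1, i1 + 1, i1 - 1), (n, 1, i1)),
              (-1, (i1, i1 + 1, n), (1, i1 - 1, i1))]) \<or>
          (1 \<le> i1 \<and> i1 < n - 1 \<and> i2 = i1 + 1 \<and> j1 = j0 + 1 \<and> j2 = i1 + 1 \<and> j3 = i1 + 2 \<and> j0 < i1 \<and>
           corresponding_S_relation n F (i1, i2) (j0, j1, j2, j3)
             [( 1, (i1, i1 + 1, j0), (j0 + 1, i1 + 1, i1 + 2)),
              (-1, (i1, i1 + 1, j0 + 1), (j0, i1 + 1, i1 + 2)),
              (-1, (i1, i1 + 1, i1 + 2), (j0, j0 + 1, i1 + 1))]))) \<and>
     ({i1, i2} \<inter> {j0, j1, j2, j3} = {j3} \<longrightarrow>
       (heronian_minor_relation n C (pluecker_relation i1 i2 j0 j1 j2 j3) \<longleftrightarrow>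
          (i1 = n - 1 \<and> i2 = n \<and> j0 = 1 \<and> j2 = j1 + 1 \<and> j3 = n \<and> 1 < j1 \<and> j1 < n \<and>
           corresponding_S_relation n F (i1, i2) (j0, j1, j2, j3)
             [( 1, (n - 1, n, 1), (j1, j1 + 1, n)),
              (-1, (n - 1, n, j1), (n, 1, j1 + 1)),
              ( 1, (n - 1, n, j1 + 1), (n, 1, j1))]) \<or>
          (i1 = 1 \<and> i2 = n \<and> j1 = j0 + 1 \<and> j2 = n - 1 \<and> j3 = n \<and> j0 < n - 2 \<and>
           corresponding_S_relation n F (i1, i2) (j0, j1, j2, j3)
             [( 1, (n, 1, j0), (j0 + 1, n - 1, n)),
              (-1, (n, 1, j0 + 1), (j0, n - 1, n)),
              ( 1, (n, 1, n - 1), (j0, j0 + 1, n))]) \<or>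
          (1 < i1 \<and> i1 \<le> n - 1 \<and> i2 = i1 + 1 \<and> j1 = j0 + 1 \<and> j2 = i1 - 1 \<and> j3 = i1 \<and> j0 < i1 - 2 \<and>
           corresponding_S_relation n F (i1, i2) (j0, j1, j2, j3)
             [( 1, (i1, i1 + 1, j0), (j0 + 1, i1 - 1, i1)),
              (-1, (i1, i1 + 1, j0 + 1), (j0, i1 - 1, i1)),
              ( 1, (i1, i1 + 1, i1 - 1), (j0, j0 + 1, i1))])))"
proof -
  interpret pluecker_indices n i1 i2 j0 j1 j2 j3
    using assms(4-12) by unfold_locales auto
  note ordered = assms(1) i_ordered j_ordered
  note corresponds = assms(2) corresponding_S_relation_iff same_S_relation_def S_relation_def
    normalize_relation_def negate_relation_def mem_heronian_triples_iff csucc_eq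
  \<comment> \<open>The classification lemmas supply the index conditions. The remaining task is to evaluate the
    displayed relation: which triples have a repeated index and which ones are of the form
    \<open>(1, b, n)\<close>. The auxiliary inequalities decide these questions.\<close>
  show ?thesis
  proof (intro conjI impI, goal_cases)
    case 1
    note meet = this
    have apart: "i1 \<notin> {j0, j1, j2, j3}" "i2 \<notin> {j0, j1, j2, j3}"
      using meet by blast+
    show ?case (is "?H \<longleftrightarrow> ?B1 \<or> ?B2 \<or> ?B3")
    proof
      assume ?H
      then consider "i1 = 1" "i2 = n" "j1 = j0 + 1" "j3 = j2 + 1"
        | "i2 = i1 + 1" "j1 = j0 + 1" "j3 = j2 + 1"
        | "i2 = i1 + 1" "j0 = 1" "j2 = j1 + 1" "j3 = n"
        unfolding heronian_iff_disjoint[OF meet] by blast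
      then show "?B1 \<or> ?B2 \<or> ?B3"
      proof cases
        case 1
        then have "1 < j0" "j3 < n"
          using apart ordered by auto
        then have ?B1 using 1 ordered by (simp add: corresponds)
        then show ?thesis by blast
      next
        case 2
        \<comment> \<open>The displayed relation is literally the defining one; both sides agree before
          normalization.\<close>
        then have ?B2
          using ordered by (auto simp: assms(2) corresponding_S_relation_iff S_relation_def
            same_S_relation_refl mem_heronian_triples_iff csucc_eq)
        then show ?thesis by blast
      next
        case 3
        \<comment> \<open>The side \<open>i\<^sub>1 i\<^sub>2\<close> lies entirely on one side of \<open>j\<^sub>1 j\<^sub>2\<close>.\<close>
        then have "1 < i1" "i2 < n" "i2 < j1 \<or> j2 < i1"
          using apart ordered by auto
        then have ?B3 using 3 ordered by (elim disjE) (auto simp: corresponds)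
        then show ?thesis by blast
      qed
    next
      assume "?B1 \<or> ?B2 \<or> ?B3"
      then show ?H
        unfolding heronian_iff_disjoint[OF meet] by blast
    qed
  next
    case 2
    note meet = this
    show ?case (is "?H \<longleftrightarrow> ?B1 \<or> ?B2 \<or> ?B3")
    proof
      assume ?H
      then consider "i1 = 1" "i2 = 2" "j0 = 1" "j2 = j1 + 1" "j3 = n"
        | "i1 = 1" "i2 = n" "j0 = 1" "j1 = 2" "j3 = j2 + 1"
        | "i2 = i1 + 1" "j0 = i1 + 1" "j1 = i1 + 2" "j3 = j2 + 1"
        unfolding heronian_iff_shared_j0[OF meet] by blast
      then show "?B1 \<or> ?B2 \<or> ?B3"
      proof cases
        case 1
        then have ?B1 using ordered meet by (simp add: corresponds)
        then show ?thesis by blast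
      next
        case 2
        then have ?B2 using ordered meet by (simp add: corresponds)
        then show ?thesis by blast
      next
        case 3
        then have ?B3 using ordered meet by (simp add: corresponds)
        then show ?thesis by blast
      qed
    next
      assume "?B1 \<or> ?B2 \<or> ?B3"
      then show ?H
        unfolding heronian_iff_shared_j0[OF meet] by blast
    qed
  next
    case 3
    note meet = this
    have apart: "i1 = j1 \<or> i1 \<notin> {j0, j1, j2, j3}" "i2 = j1 \<or> i2 \<notin> {j0, j1, j2, j3}"
      using meet by blast+
    show ?case (is "?H \<longleftrightarrow> ?B1 \<or> ?B2")
    proof
      assume ?H
      then consider "i2 = i1 + 1" "j0 = 1" "j1 = i1 + 1" "j2 = i1 + 2" "j3 = n"
        | "i1 = j0 + 1" "i2 = j0 + 2" "j1 = j0 + 1" "j3 = j2 + 1"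
        unfolding heronian_iff_shared_j1[OF meet] by blast
      then show "?B1 \<or> ?B2"
      proof cases
        case 1
        then have "1 < i1" "i1 + 1 < n"
          using apart ordered by auto
        then have ?B1 using 1 ordered by (auto simp: corresponds)
        then show ?thesis by blast
      next
        case 2
        then have "i2 < j2"
          using apart ordered by auto
        then have ?B2 using 2 ordered by (auto simp: corresponds)
        then show ?thesis by blast
      qed
    next
      assume "?B1 \<or> ?B2"
      then show ?H
        unfolding heronian_iff_shared_j1[OF meet] by auto
    qed
  next
    case 4
    note meet = this
    have apart: "i1 = j2 \<or> i1 \<notin> {j0, j1, j2, j3}" "i2 = j2 \<or> i2 \<notin> {j0, j1, j2, j3}"
      using meet by blast+
    show ?case (is "?H \<longleftrightarrow> ?B1 \<or> ?B2")
    proof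
      assume ?H
      then consider "i1 = j1 + 1" "i2 = j1 + 2" "j0 = 1" "j2 = j1 + 1" "j3 = n"
        | "i2 = i1 + 1" "j1 = j0 + 1" "j2 = i1 + 1" "j3 = i1 + 2"
        unfolding heronian_iff_shared_j2[OF meet] by blast
      then show "?B1 \<or> ?B2"
      proof cases
        case 1
        then have "1 < j1" "i1 + 1 < n"
          using apart ordered by auto
        then have ?B1 using 1 ordered by (auto simp: corresponds)
        then show ?thesis by blast
      next
        case 2
        then have "j1 < i1"
          using apart ordered by auto
        then have ?B2 using 2 ordered by (auto simp: corresponds)
        then show ?thesis by blast
      qed
    next
      assume "?B1 \<or> ?B2"
      then show ?H
        unfolding heronian_iff_shared_j2[OF meet] by auto
    qed
  next
    case 5
    note meet = this
    have apart: "i1 = j3 \<or> i1 \<notin> {j0, j1, j2, j3}" "i2 = j3 \<or> i2 \<notin> {j0, j1, j2, j3}"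
      using meet by blast+
    show ?case (is "?H \<longleftrightarrow> ?B1 \<or> ?B2 \<or> ?B3")
    proof
      assume ?H
      then consider "i1 + 1 = n" "i2 = n" "j0 = 1" "j2 = j1 + 1" "j3 = n"
        | "i1 = 1" "i2 = n" "j1 = j0 + 1" "j2 + 1 = n" "j3 = n"
        | "i1 = j2 + 1" "i2 = j2 + 2" "j1 = j0 + 1" "j3 = j2 + 1"
        unfolding heronian_iff_shared_j3[OF meet] by blast
      then show "?B1 \<or> ?B2 \<or> ?B3"
      proof cases
        case 1
        then have "j2 < i1"
          using apart ordered by auto
        then have ?B1 using 1 ordered by (auto simp: corresponds)
        then show ?thesis by blast
      next
        case 2
        then have "1 < j0" "j1 < j2"
          using apart ordered by auto
        then have ?B2 using 2 ordered by (auto simp: corresponds)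
        then show ?thesis by blast
      next
        case 3
        then have "j1 < j2"
          using apart ordered by auto
        then have ?B3 using 3 ordered by (auto simp: corresponds)
        then show ?thesis by blast
      qed
    next
      assume "?B1 \<or> ?B2 \<or> ?B3"
      then show ?H
        unfolding heronian_iff_shared_j3[OF meet] using assms(1) by (elim disjE) simp_all
    qed
  qed
qed

end
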